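(* For any integer $k \geq 2$, every $(k^2+2k-1)$-connected line graph $L(G)$ with $\delta(G) \geq k+1$ has $k$ completely independent spanning trees.
   Context: All graphs are finite, simple and undirected. $L(G)$ is the line graph of $G$ (vertex set $E(G)$, two vertices adjacent iff the corresponding edges share an endpoint). $\delta(G)$ is the minimum degree of $G$. A graph is $k$-connected if its (vertex) connectivity is at least $k$. Spanning trees $T_1,\dots,T_k$ of a graph $H$ are completely independent if for any two distinct vertices $u,v$ of $H$, the $u$–$v$ paths in $T_1,\dots,T_k$ are pairwise edge-disjoint and pairwise share no vertex other than $u$ and $v$. *)

theory Defs
  imports Main
begin

record 'a ugraph =
  verts :: "'a set"
  edges :: "'a set set"

definition simple_graph :: "'a ugraph \<Rightarrow> bool" where
  "simple_graph G \<longleftrightarrow>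
     finite (verts G) \<and> (\<forall>e \<in> edges G. e \<subseteq> verts G \<and> card e = 2)"

definition line_graph :: "'a ugraph \<Rightarrow> 'a set ugraph" where
  "line_graph G =
     \<lparr> verts = edges G,
       edges = {{e, f} | e f. e \<in> edges G \<and> f \<in> edges G \<and> e \<noteq> f \<and> e \<inter> f \<noteq> {}} \<rparr>"

definition degree :: "'a ugraph \<Rightarrow> 'a \<Rightarrow> nat" where
  "degree G v = card {e \<in> edges G. v \<in> e}"

text \<open>Unspecified for a graph without vertices.\<close>

definition min_degree :: "'a ugraph \<Rightarrow> nat" where
  "min_degree G = Min (degree G ` verts G)"

text \<open>A path is given by its nonempty list of successive vertices.\<close>

definition path_edges :: "'a list \<Rightarrow> 'a set set" where
  "path_edges p = {{p ! i, p ! Suc i} | i. Suc i < length p}"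

definition is_path :: "'a ugraph \<Rightarrow> 'a list \<Rightarrow> bool" where
  "is_path G p \<longleftrightarrow>
     p \<noteq> [] \<and> distinct p \<and> set p \<subseteq> verts G \<and> path_edges p \<subseteq> edges G"

definition path_between :: "'a ugraph \<Rightarrow> 'a \<Rightarrow> 'a \<Rightarrow> 'a list \<Rightarrow> bool" where
  "path_between G u v p \<longleftrightarrow> is_path G p \<and> hd p = u \<and> last p = v"

definition connected_graph :: "'a ugraph \<Rightarrow> bool" where
  "connected_graph G \<longleftrightarrow>
     verts G \<noteq> {} \<and> (\<forall>u \<in> verts G. \<forall>v \<in> verts G. \<exists>p. path_between G u v p)"

text \<open>A cycle is a path on at least three vertices, closed by an edge between its ends.\<close>

definition is_cycle :: "'a ugraph \<Rightarrow> 'a list \<Rightarrow> bool" where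
  "is_cycle G c \<longleftrightarrow> is_path G c \<and> length c \<ge> 3 \<and> {last c, hd c} \<in> edges G"

definition is_tree :: "'a ugraph \<Rightarrow> bool" where
  "is_tree T \<longleftrightarrow> simple_graph T \<and> connected_graph T \<and> (\<nexists>c. is_cycle T c)"

definition spanning_tree :: "'a ugraph \<Rightarrow> 'a ugraph \<Rightarrow> bool" where
  "spanning_tree H T \<longleftrightarrow> is_tree T \<and> verts T = verts H \<and> edges T \<subseteq> edges H"

definition delete_verts :: "'a ugraph \<Rightarrow> 'a set \<Rightarrow> 'a ugraph" where
  "delete_verts G S =
     \<lparr> verts = verts G - S, edges = {e \<in> edges G. e \<inter> S = {}} \<rparr>"

text \<open>
  The least number of vertices whose removal leaves a graph that is disconnected or has at
  most one vertex; the second alternative gives complete graphs on \<open>n \<ge> 1\<close> vertices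
  connectivity \<open>n - 1\<close>.
\<close>

definition vertex_connectivity :: "'a ugraph \<Rightarrow> nat" where
  "vertex_connectivity G =
     Min (card ` {S. S \<subseteq> verts G \<and>
       (\<not> connected_graph (delete_verts G S) \<or> card (verts (delete_verts G S)) \<le> 1)})"

definition k_connected :: "nat \<Rightarrow> 'a ugraph \<Rightarrow> bool" where
  "k_connected k G \<longleftrightarrow> vertex_connectivity G \<ge> k"

text \<open>
  In a tree the path between two given vertices exists and is unique, so quantifying over
  all \<open>u\<close>-\<open>v\<close> paths of each tree speaks about \<^emph>\<open>the\<close> \<open>u\<close>-\<open>v\<close> path.
\<close>

definition completely_independent ::
    "'a ugraph \<Rightarrow> nat \<Rightarrow> (nat \<Rightarrow> 'a ugraph) \<Rightarrow> bool" where
  "completely_independent H k T \<longleftrightarrow>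
     (\<forall>i < k. spanning_tree H (T i)) \<and>
     (\<forall>u \<in> verts H. \<forall>v \<in> verts H. u \<noteq> v \<longrightarrow>
       (\<forall>i < k. \<forall>j < k. i \<noteq> j \<longrightarrow>
         (\<forall>p q. path_between (T i) u v p \<and> path_between (T j) u v q \<longrightarrow>
           path_edges p \<inter> path_edges q = {} \<and> set p \<inter> set q \<subseteq> {u, v})))"

definition has_completely_independent_spanning_trees :: "'a ugraph \<Rightarrow> nat \<Rightarrow> bool" where
  "has_completely_independent_spanning_trees H k \<longleftrightarrow> (\<exists>T. completely_independent H k T)"

end

theory Submission
  imports Defs Complex_Main
begin

text \<open>
  Connectivity of the line graph gives \<open>deg u + deg v \<ge> k\<^sup>2 + 2k + 1\<close> for every edge \<open>uv\<close> of \<open>G\<close>, and at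
  least \<open>k\<^sup>2 + 2k - 1\<close> edges in every edge cut of \<open>G\<close> with an edge on both sides. Together with the
  minimum degree this bounds from below the number of edges crossing any partition of the vertices,
  as the tree-packing theorem of Nash-Williams and Tutte requires, so \<open>G\<close> has \<open>k\<close> edge-disjoint
  spanning trees \<open>F\<^sub>i\<close>. In the line graph each \<open>F\<^sub>i\<close> induces a connected subgraph, which is
  extended to a spanning tree by attaching the edges outside \<open>F\<^sub>i\<close> as leaves. The inner vertices of
  different trees are then disjoint, and the leaves can be attached so that no edge is used twice.
\<close>

section \<open>Connection by a set of edges\<close>

definition adjacency :: "'a set set \<Rightarrow> 'a rel" where
  "adjacency F = {(u, v). {u, v} \<in> F}"

text \<open>Reachability depends on the edge set alone and every point reaches itself, so edge sets
  can be varied without carrying a vertex set along.\<close>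

definition linked :: "'a set set \<Rightarrow> 'a rel" where
  "linked F = (adjacency F)\<^sup>*"

lemma linked_refl [simp]: "(u, u) \<in> linked F"
  by (simp add: linked_def)

lemma linked_sym: "(u, v) \<in> linked F \<Longrightarrow> (v, u) \<in> linked F"
proof -
  have "sym (adjacency F)"
    by (auto simp: sym_def adjacency_def insert_commute)
  then show "(u, v) \<in> linked F \<Longrightarrow> (v, u) \<in> linked F"
    unfolding linked_def by (meson sym_rtrancl symD)
qed

lemma linked_trans: "(u, v) \<in> linked F \<Longrightarrow> (v, w) \<in> linked F \<Longrightarrow> (u, w) \<in> linked F"
  unfolding linked_def by (rule rtrancl_trans)

lemma linked_edge: "{u, v} \<in> F \<Longrightarrow> (u, v) \<in> linked F"
  unfolding linked_def adjacency_def by auto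

lemma linked_least:
  assumes "(x, y) \<in> linked F" and "\<And>u v. {u, v} \<in> F \<Longrightarrow> (u, v) \<in> linked F'"
  shows "(x, y) \<in> linked F'"
  using assms(1) unfolding linked_def
proof (induction rule: rtrancl_induct)
  case base
  then show ?case by simp
next
  case (step y z)
  then have "(y, z) \<in> linked F'"
    using assms(2) by (simp add: adjacency_def)
  then show ?case
    using step.IH unfolding linked_def by (meson rtrancl_trans)
qed

lemma linked_mono: "(x, y) \<in> linked F \<Longrightarrow> F \<subseteq> F' \<Longrightarrow> (x, y) \<in> linked F'"
  by (erule linked_least) (auto intro: linked_edge)

lemma linked_closed:
  assumes "(x, y) \<in> linked F" and "x \<in> X"
    and "\<And>u v. {u, v} \<in> F \<Longrightarrow> u \<in> X \<Longrightarrow> v \<in> X"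
  shows "y \<in> X"
  using assms(1) unfolding linked_def
  by (induction rule: rtrancl_induct) (auto simp: adjacency_def assms(2) intro: assms(3))

text \<open>The vertices reached without \<open>{a, b}\<close>, or after crossing it once in either
  direction, are closed under all edges: a further crossing leads to nothing new.\<close>

lemma linked_insert_cases:
  assumes "(x, y) \<in> linked (insert {a, b} F)" and "(x, y) \<notin> linked F"
  shows "((x, a) \<in> linked F \<and> (b, y) \<in> linked F) \<or> ((x, b) \<in> linked F \<and> (a, y) \<in> linked F)"
proof -
  let ?X = "{z. (x, z) \<in> linked F \<or> ((x, a) \<in> linked F \<and> (b, z) \<in> linked F)
    \<or> ((x, b) \<in> linked F \<and> (a, z) \<in> linked F)}"
  have "y \<in> ?X"
  proof (rule linked_closed[OF assms(1)])
    show "x \<in> ?X" by simp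
  next
    fix u v assume uv: "{u, v} \<in> insert {a, b} F" and u: "u \<in> ?X"
    show "v \<in> ?X"
    proof (cases "{u, v} \<in> F")
      case True
      then have "(u, v) \<in> linked F" by (rule linked_edge)
      then show ?thesis using u linked_trans[of _ u F v] by auto
    next
      case False
      then have "u = a \<and> v = b \<or> u = b \<and> v = a"
        using uv by (auto simp: doubleton_eq_iff)
      then show ?thesis using u by auto
    qed
  qed
  then show ?thesis using assms(2) by blast
qed

lemma linked_insert_redundant:
  assumes "(a, b) \<in> linked F"
  shows "linked (insert {a, b} F) = linked F"
proof -
  have "(x, y) \<in> linked F" if "(x, y) \<in> linked (insert {a, b} F)" for x y
    using linked_insert_cases[OF that] assms linked_trans linked_sym by metis
  then show ?thesis by (auto intro: linked_mono)
qed

section \<open>Forests\<close>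

text \<open>Acyclicity stated without cycles: every edge is a bridge. As \<open>linked\<close> is
  reflexive, loops \<open>{u}\<close> are excluded too.\<close>

definition forest :: "'a set set \<Rightarrow> bool" where
  "forest F \<longleftrightarrow> (\<forall>u v. {u, v} \<in> F \<longrightarrow> (u, v) \<notin> linked (F - {{u, v}}))"

lemma forest_subset: "forest F \<Longrightarrow> F' \<subseteq> F \<Longrightarrow> forest F'"
  unfolding forest_def
proof (intro allI impI notI)
  fix u v assume F: "\<forall>u v. {u, v} \<in> F \<longrightarrow> (u, v) \<notin> linked (F - {{u, v}})" "F' \<subseteq> F"
    and uv: "{u, v} \<in> F'" "(u, v) \<in> linked (F' - {{u, v}})"
  have "(u, v) \<in> linked (F - {{u, v}})"
    using uv(2) by (rule linked_mono) (use F(2) in auto)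
  then show False using F uv(1) by auto
qed

text \<open>If an old edge \<open>{u, v}\<close> stopped being a bridge, the detour around it would
  use \<open>{a, b}\<close>; the rest of the detour together with \<open>{u, v}\<close> would then
  link \<open>a\<close> and \<open>b\<close> in \<open>F\<close>.\<close>

lemma forest_insert:
  assumes "forest F" and "(a, b) \<notin> linked F"
  shows "forest (insert {a, b} F)"
  unfolding forest_def
proof (intro allI impI notI)
  fix u v assume uv: "{u, v} \<in> insert {a, b} F"
    and l: "(u, v) \<in> linked (insert {a, b} F - {{u, v}})"
  have abF: "{a, b} \<notin> F" using assms(2) linked_edge[of a b F] by auto
  show False
  proof (cases "{u, v} = {a, b}")
    case True
    then have "(u, v) \<in> linked F" using l abF by simp
    then show False using True assms(2) linked_sym by (metis doubleton_eq_iff)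
  next
    case False
    then have uvF: "{u, v} \<in> F" using uv by simp
    let ?F = "F - {{u, v}}"
    have "(u, v) \<in> linked (insert {a, b} ?F)"
      using l False by (simp add: insert_Diff_if)
    moreover have "(u, v) \<notin> linked ?F"
      using assms(1) uvF by (simp add: forest_def)
    ultimately have "((u, a) \<in> linked ?F \<and> (b, v) \<in> linked ?F) \<or> ((u, b) \<in> linked ?F \<and> (a, v) \<in> linked ?F)"
      by (rule linked_insert_cases)
    then have "((u, a) \<in> linked F \<and> (b, v) \<in> linked F) \<or> ((u, b) \<in> linked F \<and> (a, v) \<in> linked F)"
      using linked_mono[of _ _ ?F F] by auto
    then show False using assms(2) linked_edge[OF uvF] linked_sym linked_trans by metis
  qed
qed

text \<open>The set \<open>M\<close> is the edge set of the path from \<open>x\<close> to \<open>y\<close>, obtained as a minimal connecting set.\<close>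

lemma forest_path_edges:
  assumes "forest F" and "finite F" and "\<And>e. e \<in> F \<Longrightarrow> card e = 2" and "(x, y) \<in> linked F"
  obtains M where "M \<subseteq> F" and "(x, y) \<in> linked M"
    and "\<And>f. f \<in> M \<Longrightarrow> (x, y) \<notin> linked (F - {f})"
proof -
  let ?S = "{M. M \<subseteq> F \<and> (x, y) \<in> linked M}"
  have "finite ?S" "?S \<noteq> {}" using assms by auto
  then obtain M where M: "M \<in> ?S" and min: "\<And>N. N \<in> ?S \<Longrightarrow> N \<subseteq> M \<Longrightarrow> M = N"
    using finite_has_minimal by (metis (no_types, lifting))
  have "(x, y) \<notin> linked (F - {f})" if f: "f \<in> M" for f
  proof
    assume l: "(x, y) \<in> linked (F - {f})"
    obtain a b where ab: "f = {a, b}" using assms(3)[of f] M f by (auto simp: card_2_iff)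
    \<comment> \<open>By minimality, \<open>M - {f}\<close> links \<open>x\<close> and
      \<open>y\<close> to opposite ends of \<open>f\<close>. A link of \<open>x\<close> and
      \<open>y\<close> avoiding \<open>f\<close> would join these ends, so \<open>f\<close> would
      not be a bridge.\<close>
    have "(x, y) \<notin> linked (M - {f})" using min[of "M - {f}"] M f by auto
    moreover have "(x, y) \<in> linked (insert {a, b} (M - {f}))"
      using M f ab by (simp add: insert_absorb)
    ultimately have "((x, a) \<in> linked (M - {f}) \<and> (b, y) \<in> linked (M - {f}))
      \<or> ((x, b) \<in> linked (M - {f}) \<and> (a, y) \<in> linked (M - {f}))"
      by (intro linked_insert_cases)
    moreover have "M - {f} \<subseteq> F - {f}" using M by auto
    ultimately have "((x, a) \<in> linked (F - {f}) \<and> (b, y) \<in> linked (F - {f}))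
      \<or> ((x, b) \<in> linked (F - {f}) \<and> (a, y) \<in> linked (F - {f}))"
      using linked_mono[of _ _ "M - {f}" "F - {f}"] by auto
    then have "(a, b) \<in> linked (F - {f})" using l linked_sym linked_trans by metis
    then show False using assms(1) f M ab unfolding forest_def by auto
  qed
  with M show thesis using that by blast
qed

section \<open>Components and the number of edges of a forest\<close>

definition components :: "'a set \<Rightarrow> 'a set set \<Rightarrow> 'a set set" where
  "components V F = (\<lambda>v. linked F `` {v}) ` V"

lemma linked_class_eq: "linked F `` {u} = linked F `` {v} \<longleftrightarrow> (u, v) \<in> linked F"
proof
  assume "linked F `` {u} = linked F `` {v}"
  then have "v \<in> linked F `` {u}" by simp
  then show "(u, v) \<in> linked F" by simp
next
  assume "(u, v) \<in> linked F"
  then have "(u, z) \<in> linked F \<longleftrightarrow> (v, z) \<in> linked F" for z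
    by (metis linked_sym linked_trans)
  then show "linked F `` {u} = linked F `` {v}" by auto
qed

text \<open>The classes of \<open>a\<close> and \<open>b\<close> merge into one and all others stay
  as they are; \<open>cls\<close> describes every class after the insertion.\<close>

lemma card_components_insert:
  assumes "finite V" and "a \<in> V" and "b \<in> V" and "(a, b) \<notin> linked F"
  shows "Suc (card (components V (insert {a, b} F))) = card (components V F)"
proof -
  let ?A = "linked F `` {a}" and ?B = "linked F `` {b}"
  have cls: "linked (insert {a, b} F) `` {v} =
    (if v \<in> ?A \<or> v \<in> ?B then ?A \<union> ?B else linked F `` {v})" for v
  proof -
    let ?L = "linked (insert {a, b} F)"
    have ab: "(a, b) \<in> ?L" by (rule linked_edge) simp
    have sub: "(x, y) \<in> ?L" if "(x, y) \<in> linked F" for x y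
      using that by (rule linked_mono) auto
    have *: "(v, z) \<in> ?L \<longleftrightarrow>
       (if v \<in> ?A \<or> v \<in> ?B then z \<in> ?A \<or> z \<in> ?B else (v, z) \<in> linked F)" for z
    proof (cases "v \<in> ?A \<or> v \<in> ?B")
      case True
      have "(v, z) \<in> ?L" if "z \<in> ?A \<or> z \<in> ?B"
      proof -
        have "(a, v) \<in> ?L" "(a, z) \<in> ?L"
          using True that sub ab linked_trans[of a b] by auto
        then show ?thesis using linked_sym linked_trans by metis
      qed
      moreover have "z \<in> ?A \<or> z \<in> ?B" if "(v, z) \<in> ?L"
      proof (cases "(v, z) \<in> linked F")
        case 1: True
        then show ?thesis using True linked_trans[OF _ 1] by auto
      next
        case False
        then show ?thesis using linked_insert_cases[OF that] by auto
      qed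
      ultimately show ?thesis using True by auto
    next
      case False
      then have "(v, a) \<notin> linked F" "(v, b) \<notin> linked F" by (auto dest: linked_sym)
      then show ?thesis using False sub linked_insert_cases[of v z a b F] by auto
    qed
    show ?thesis by (rule set_eqI) (use * in auto)
  qed
  have ne: "?A \<noteq> ?B" using assms(4) by (simp add: linked_class_eq)
  have fin: "finite (components V F)" using assms(1) by (simp add: components_def)
  have AB: "?A \<in> components V F" "?B \<in> components V F" using assms by (auto simp: components_def)
  \<comment> \<open>The merged class is not an old one, so replacing two classes by it lowers the
    count by exactly one.\<close>
  have dis: "?A \<union> ?B \<notin> components V F"
  proof
    assume "?A \<union> ?B \<in> components V F"
    then obtain v where v: "?A \<union> ?B = linked F `` {v}" by (auto simp: components_def)
    moreover have "a \<in> ?A \<union> ?B" "b \<in> ?A \<union> ?B" by auto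
    ultimately have "a \<in> linked F `` {v}" "b \<in> linked F `` {v}" by simp_all
    then have "(v, a) \<in> linked F" "(v, b) \<in> linked F" by simp_all
    then show False using assms(4) linked_sym linked_trans by metis
  qed
  have "components V (insert {a, b} F) = insert (?A \<union> ?B) (components V F - {?A, ?B})"
  proof (rule set_eqI, rule iffI)
    fix X assume "X \<in> components V (insert {a, b} F)"
    then obtain v where v: "v \<in> V" "X = linked (insert {a, b} F) `` {v}" by (auto simp: components_def)
    show "X \<in> insert (?A \<union> ?B) (components V F - {?A, ?B})"
    proof (cases "v \<in> ?A \<or> v \<in> ?B")
      case True
      then show ?thesis using v cls by auto
    next
      case False
      then have "X = linked F `` {v}" using v cls by simp
      moreover have "linked F `` {v} \<noteq> ?A" "linked F `` {v} \<noteq> ?B"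
        using False by (auto simp only: linked_class_eq Image_singleton_iff dest: linked_sym)
      ultimately show ?thesis using v(1) by (simp add: components_def)
    qed
  next
    fix X assume "X \<in> insert (?A \<union> ?B) (components V F - {?A, ?B})"
    then consider "X = ?A \<union> ?B" | "X \<in> components V F" "X \<noteq> ?A" "X \<noteq> ?B" by blast
    then show "X \<in> components V (insert {a, b} F)"
    proof cases
      case 1
      then have "X = linked (insert {a, b} F) `` {a}" using cls[of a] by simp
      then show ?thesis using assms(2) by (simp add: components_def)
    next
      case 2
      then obtain v where v: "v \<in> V" "X = linked F `` {v}" by (auto simp: components_def)
      then have "v \<notin> ?A" "v \<notin> ?B" using 2
        by (auto simp only: linked_class_eq Image_singleton_iff dest: linked_sym)
      then have "X = linked (insert {a, b} F) `` {v}" using v cls by simp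
      then show ?thesis using v by (simp add: components_def)
    qed
  qed
  then have "card (components V (insert {a, b} F)) = Suc (card (components V F - {?A, ?B}))"
    using fin dis by simp
  also have "card (components V F - {?A, ?B}) = card (components V F) - 2"
    using AB ne fin by (simp add: card_Diff_subset)
  finally show ?thesis
    using card_mono[OF fin, of "{?A, ?B}"] AB ne by simp
qed

text \<open>Without edges every vertex is a class of its own; each edge of a forest, being a bridge,
  then merges two classes.\<close>

lemma card_components_forest:
  assumes "finite V" and "finite F" and "forest F" and "\<And>e. e \<in> F \<Longrightarrow> e \<subseteq> V \<and> card e = 2"
  shows "card (components V F) + card F = card V"
  using assms(2-4)
proof (induction F rule: finite_induct)
  case empty
  have "linked {} = Id" by (simp add: linked_def adjacency_def)
  then have "components V {} = (\<lambda>v. {v}) ` V" by (auto simp: components_def)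
  then show ?case by (simp add: card_image)
next
  case (insert e F)
  obtain a b where ab: "e = {a, b}" using insert.prems(2)[of e] by (auto simp: card_2_iff)
  have "(a, b) \<notin> linked F"
    using insert.prems(1) insert.hyps ab unfolding forest_def by auto
  moreover have "a \<in> V" "b \<in> V" using insert.prems(2) ab by auto
  ultimately have "Suc (card (components V (insert e F))) = card (components V F)"
    using card_components_insert assms(1) ab by simp
  moreover have "card (components V F) + card F = card V"
    using insert.IH insert.prems forest_subset by (metis insertCI subset_insertI)
  ultimately show ?case using insert.hyps by simp
qed

section \<open>Packing spanning trees\<close>

definition packing :: "nat \<Rightarrow> 'a set set \<Rightarrow> (nat \<Rightarrow> 'a set set) \<Rightarrow> bool" where
  "packing k E F \<longleftrightarrow> (\<forall>i<k. F i \<subseteq> E \<and> forest (F i)) \<and> (\<forall>i<k. \<forall>j<k. i \<noteq> j \<longrightarrow> F i \<inter> F j = {})"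

text \<open>The forests need not span; the total number of their edges is maximised. The maximum is
  the rank of \<open>E\<close> in the \<open>k\<close>-fold union of its graphic matroid.\<close>

definition max_packing :: "nat \<Rightarrow> 'a set set \<Rightarrow> (nat \<Rightarrow> 'a set set) \<Rightarrow> bool" where
  "max_packing k E F \<longleftrightarrow> packing k E F \<and>
     (\<forall>F'. packing k E F' \<longrightarrow> (\<Sum>i<k. card (F' i)) \<le> (\<Sum>i<k. card (F i)))"

text \<open>An uncovered edge \<open>e\<close> takes the place of \<open>f\<close>, which becomes
  uncovered. Both packings are required to be maximum, so chains of exchanges stay among maximum
  packings.\<close>

definition exchange :: "nat \<Rightarrow> 'a set set \<Rightarrow> (nat \<Rightarrow> 'a set set) \<Rightarrow> (nat \<Rightarrow> 'a set set) \<Rightarrow> bool" where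
  "exchange k E F F' \<longleftrightarrow> max_packing k E F \<and> max_packing k E F' \<and>
     (\<exists>i<k. \<exists>e \<in> E. \<exists>f \<in> F i. (\<forall>j<k. e \<notin> F j) \<and> F' = F(i := insert e (F i - {f})))"

section \<open>Maximum packings and their exchanges\<close>

lemma max_packing_exists:
  assumes "finite E"
  obtains F where "max_packing k E F"
proof -
  have "packing k E (\<lambda>_. {})" by (simp add: packing_def forest_def)
  moreover have "\<forall>F. packing k E F \<longrightarrow> (\<Sum>i<k. card (F i)) < Suc (\<Sum>i<k. card E)"
    by (intro allI impI le_imp_less_Suc sum_mono card_mono assms) (simp add: packing_def)
  ultimately have "\<exists>F. max_packing k E F"
    unfolding max_packing_def by (rule ex_has_greatest_nat[where f = "\<lambda>F. \<Sum>i<k. card (F i)"])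
  then show thesis using that by blast
qed

lemma sum_card_fun_upd:
  "i < k \<Longrightarrow> (\<Sum>j<k. card ((F(i := X)) j)) + card (F i) = (\<Sum>j<k. card (F j)) + card X" for k :: nat
  by (simp add: sum.remove[of "{..<k}" i])

lemma packing_fun_upd:
  assumes "packing k E F" and "e \<in> E" and "\<forall>j<k. e \<notin> F j"
    and "X \<subseteq> insert e (F i)" and "forest X"
  shows "packing k E (F(i := X))"
  unfolding packing_def
proof (intro conjI allI impI)
  fix j assume "j < k"
  then show "(F(i := X)) j \<subseteq> E" "forest ((F(i := X)) j)"
    using assms by (auto simp: packing_def)
next
  fix j l assume "j < k" "l < k" "j \<noteq> l"
  then have "F j \<inter> F l = {}" using assms(1) by (simp add: packing_def)
  then show "(F(i := X)) j \<inter> (F(i := X)) l = {}"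
    using \<open>j < k\<close> \<open>l < k\<close> \<open>j \<noteq> l\<close> assms(3,4) by auto
qed

text \<open>Otherwise the uncovered edge could be added to \<open>F i\<close>, giving a larger
  packing.\<close>

lemma max_packing_linked:
  assumes "finite E" and mp: "max_packing k E F" and "i < k"
    and e: "{x, y} \<in> E" "\<forall>j<k. {x, y} \<notin> F j"
  shows "(x, y) \<in> linked (F i)"
proof (rule ccontr)
  assume "(x, y) \<notin> linked (F i)"
  then have "forest (insert {x, y} (F i))"
    using mp \<open>i < k\<close> by (intro forest_insert) (auto simp: max_packing_def packing_def)
  then have "packing k E (F(i := insert {x, y} (F i)))"
    using mp e by (intro packing_fun_upd) (auto simp: max_packing_def)
  then have "(\<Sum>j<k. card ((F(i := insert {x, y} (F i))) j)) \<le> (\<Sum>j<k. card (F j))"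
    using mp unfolding max_packing_def by blast
  moreover have "finite (F i)"
    using mp \<open>i < k\<close> \<open>finite E\<close> by (meson finite_subset max_packing_def packing_def)
  ultimately show False
    using sum_card_fun_upd[OF \<open>i < k\<close>, of F "insert {x, y} (F i)"] e(2) \<open>i < k\<close> by simp
qed

text \<open>Since \<open>F i - {f}\<close> separates \<open>x\<close> and \<open>y\<close>, the new
  set is again a forest; the total number of edges is unchanged, hence still maximum.\<close>

lemma max_packing_exchange:
  assumes "finite E" and mp: "max_packing k E F" and "i < k"
    and e: "{x, y} \<in> E" "\<forall>j<k. {x, y} \<notin> F j"
    and f: "f \<in> F i" "(x, y) \<notin> linked (F i - {f})"
  shows "exchange k E F (F(i := insert {x, y} (F i - {f})))"
proof -
  let ?X = "insert {x, y} (F i - {f})"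
  have "forest (F i)" using mp \<open>i < k\<close> by (simp add: max_packing_def packing_def)
  then have "forest ?X" using f(2) by (intro forest_insert) (auto intro: forest_subset)
  then have "packing k E (F(i := ?X))"
    using mp e by (intro packing_fun_upd) (auto simp: max_packing_def)
  moreover have "finite (F i)"
    using mp \<open>i < k\<close> \<open>finite E\<close> by (meson finite_subset max_packing_def packing_def)
  then have "card ?X = card (F i)"
    using e(2) f(1) \<open>i < k\<close> card_Suc_Diff1[of "F i" f] by simp
  then have "(\<Sum>j<k. card ((F(i := ?X)) j)) = (\<Sum>j<k. card (F j))"
    using sum_card_fun_upd[OF \<open>i < k\<close>, of F ?X] by simp
  ultimately have "max_packing k E (F(i := ?X))"
    using mp unfolding max_packing_def by simp
  then show ?thesis using mp assms unfolding exchange_def by blast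
qed

text \<open>Let \<open>A\<close> collect the edges missed by some packing that arises from a maximum packing \<open>F\<close> by
  exchanges. Exchanges do not change which vertices are linked by \<open>F i \<inter> A\<close>.\<close>

lemma max_packing_closed_set:
  assumes "finite E" and card2: "\<And>e. e \<in> E \<Longrightarrow> card e = 2" and mp: "max_packing k E F"
  obtains A where "A \<subseteq> E" and "\<And>e. e \<in> E - A \<Longrightarrow> \<exists>i<k. e \<in> F i"
    and "\<And>i. i < k \<Longrightarrow> linked (F i \<inter> A) = linked A"
proof -
  define R where "R = {F'. (exchange k E)\<^sup>*\<^sup>* F F'}"
  define A where "A = {e \<in> E. \<exists>F' \<in> R. \<forall>j<k. e \<notin> F' j}"
  have R_max: "max_packing k E F'" if "F' \<in> R" for F'
    using that mp unfolding R_def by (auto elim: rtranclp.cases simp: exchange_def)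
  \<comment> \<open>Let \<open>M\<close> be the path in \<open>F' i\<close> between the ends of an
    uncovered edge. Exchanging any \<open>f\<close> in \<open>M\<close> for that edge leaves
    \<open>f\<close> uncovered, so the whole path lies in \<open>A\<close>.\<close>
  have missed: "(x, y) \<in> linked (F' i \<inter> A)"
    if F': "F' \<in> R" and i: "i < k" and e: "{x, y} \<in> E" "\<forall>j<k. {x, y} \<notin> F' j" for F' i x y
  proof -
    have mp': "max_packing k E F'" using F' by (rule R_max)
    have sub: "F' i \<subseteq> E" and "forest (F' i)" and dis: "\<And>j. j < k \<Longrightarrow> j \<noteq> i \<Longrightarrow> F' i \<inter> F' j = {}"
      using mp' i by (auto simp: max_packing_def packing_def)
    moreover have "finite (F' i)" using sub \<open>finite E\<close> by (rule finite_subset)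
    moreover have "(x, y) \<in> linked (F' i)"
      using \<open>finite E\<close> mp' i e by (rule max_packing_linked)
    moreover have "card e = 2" if "e \<in> F' i" for e
      using card2 sub that by auto
    ultimately obtain M where M: "M \<subseteq> F' i" "(x, y) \<in> linked M"
      "\<And>f. f \<in> M \<Longrightarrow> (x, y) \<notin> linked (F' i - {f})"
      using forest_path_edges[of "F' i" x y] by metis
    have "f \<in> A" if f: "f \<in> M" for f
    proof -
      let ?F = "F'(i := insert {x, y} (F' i - {f}))"
      have fi: "f \<in> F' i" using M f by auto
      have "exchange k E F' ?F"
        using \<open>finite E\<close> mp' i e fi M(3)[OF f] by (rule max_packing_exchange)
      then have "?F \<in> R" using F' unfolding R_def by auto
      moreover have "f \<noteq> {x, y}" using fi e(2) i by auto
      then have "\<forall>j<k. f \<notin> ?F j" using fi dis by auto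
      ultimately show ?thesis using fi sub unfolding A_def by blast
    qed
    then have "M \<subseteq> F' i \<inter> A" using M(1) by auto
    then show ?thesis by (rule linked_mono[OF M(2)])
  qed
  have exch_inv: "linked (F'' i \<inter> A) = linked (F' i \<inter> A)"
    if F': "F' \<in> R" and ex: "exchange k E F' F''" and i: "i < k" for F' F'' i
  proof -
    have F'': "F'' \<in> R" using F' ex unfolding R_def by auto
    obtain j e f where j: "j < k" and e: "e \<in> E" "\<forall>l<k. e \<notin> F' l" and f: "f \<in> F' j"
      and eq: "F'' = F'(j := insert e (F' j - {f}))"
      using ex unfolding exchange_def by blast
    show ?thesis
    proof (cases "i = j")
      case False
      then show ?thesis using eq by simp
    next
      case True
      have pk: "packing k E F'" using R_max[OF F'] by (simp add: max_packing_def)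
      have fE: "f \<in> E" using pk f j by (auto simp: packing_def)
      have ne: "f \<noteq> e" using e f j by auto
      have "f \<notin> F' l" if "l < k" "l \<noteq> j" for l
        using pk f j that unfolding packing_def by blast
      then have fm: "\<forall>l<k. f \<notin> F'' l"
        using eq ne by simp
      obtain x y where xy: "e = {x, y}" using card2[OF e(1)] by (auto simp: card_2_iff)
      obtain u v where uv: "f = {u, v}" using card2[OF fE] by (auto simp: card_2_iff)
      \<comment> \<open>The edge \<open>e\<close> is uncovered by \<open>F'\<close> and
        \<open>f\<close> by \<open>F''\<close>, so \<open>missed\<close> applies to both. Each is
        redundant for linking, and \<open>F' j \<inter> A\<close> and
        \<open>F'' j \<inter> A\<close> differ in these two edges at most.\<close>
      have l1: "(x, y) \<in> linked (F' j \<inter> A)" using missed[OF F' j] e xy by simp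
      have l2: "(u, v) \<in> linked (F'' j \<inter> A)" using missed[OF F'' j] fE fm uv by simp
      have "F'' j \<inter> A \<subseteq> insert {x, y} (F' j \<inter> A)" "F' j \<inter> A \<subseteq> insert {u, v} (F'' j \<inter> A)"
        using eq xy uv by auto
      then have "(a, b) \<in> linked (F'' j \<inter> A) \<longleftrightarrow> (a, b) \<in> linked (F' j \<inter> A)" for a b
        using linked_mono[of a b] linked_insert_redundant[OF l1] linked_insert_redundant[OF l2] by metis
      then show ?thesis using True by auto
    qed
  qed
  have inv: "linked (F' i \<inter> A) = linked (F i \<inter> A)" if "F' \<in> R" and i: "i < k" for F' i
  proof -
    have "(exchange k E)\<^sup>*\<^sup>* F F'" using that by (simp add: R_def)
    then show ?thesis
    proof (induction rule: rtranclp_induct)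
      case base
      then show ?case by simp
    next
      case (step G H)
      then show ?case using exch_inv[of G H i] i by (simp add: R_def)
    qed
  qed
  have "linked (F i \<inter> A) = linked A" if i: "i < k" for i
  proof -
    \<comment> \<open>An edge of \<open>A\<close> is uncovered by some packing in \<open>R\<close>,
      where \<open>missed\<close> links its ends; \<open>inv\<close> carries the link back to
      \<open>F\<close>.\<close>
    have "(u, v) \<in> linked (F i \<inter> A)" if "{u, v} \<in> A" for u v
    proof -
      obtain F' where "F' \<in> R" "{u, v} \<in> E" "\<forall>j<k. {u, v} \<notin> F' j"
        using \<open>{u, v} \<in> A\<close> unfolding A_def by blast
      then show ?thesis using missed[OF _ i] inv[OF _ i] by metis
    qed
    then have "(a, b) \<in> linked A \<Longrightarrow> (a, b) \<in> linked (F i \<inter> A)" for a b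
      using linked_least by metis
    then show ?thesis by (auto intro: linked_mono)
  qed
  moreover have "\<exists>i<k. e \<in> F i" if "e \<in> E - A" for e
    using that unfolding A_def R_def by blast
  ultimately show thesis using that[of A] unfolding A_def by blast
qed

text \<open>The tree-packing theorem of Nash-Williams and Tutte; the function \<open>c\<close> encodes the partition
  of \<open>V\<close> into its fibres.\<close>

theorem tree_packing:
  fixes V :: "'a set" and E :: "'a set set"
  assumes "finite V" and edge: "\<And>e. e \<in> E \<Longrightarrow> e \<subseteq> V \<and> card e = 2"
    and cross: "\<And>c :: 'a \<Rightarrow> 'a set. k * (card (c ` V) - 1) \<le> card {e \<in> E. \<exists>u \<in> e. \<exists>v \<in> e. c u \<noteq> c v}"
  obtains F where "\<And>i. i < k \<Longrightarrow> F i \<subseteq> E"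
    and "\<And>i j. i < k \<Longrightarrow> j < k \<Longrightarrow> i \<noteq> j \<Longrightarrow> F i \<inter> F j = {}"
    and "\<And>i u v. i < k \<Longrightarrow> u \<in> V \<Longrightarrow> v \<in> V \<Longrightarrow> (u, v) \<in> linked (F i)"
proof -
  have finE: "finite E" using edge \<open>finite V\<close> by (meson Pow_iff finite_Pow_iff finite_subset subsetI)
  obtain F where mp: "max_packing k E F" using max_packing_exists[OF finE] .
  have F: "F i \<subseteq> E" "forest (F i)" if "i < k" for i
    using mp that by (auto simp: max_packing_def packing_def)
  have dis: "F i \<inter> F j = {}" if "i < k" "j < k" "i \<noteq> j" for i j
    using mp that by (auto simp: max_packing_def packing_def)
  have finF: "finite (F i)" if "i < k" for i using F(1)[OF that] finE by (rule finite_subset)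
  obtain A where A: "A \<subseteq> E" "\<And>e. e \<in> E - A \<Longrightarrow> \<exists>i<k. e \<in> F i"
    "\<And>i. i < k \<Longrightarrow> linked (F i \<inter> A) = linked A"
    using max_packing_closed_set[OF finE _ mp] edge by metis
  let ?n = "card V" and ?c = "card (components V A)"
  have rank: "card (components V X) + card X = ?n" if "X \<subseteq> F i" "i < k" for X i
  proof (rule card_components_forest)
    show "finite X" using that finF finite_subset by blast
    show "forest X" using that F(2) forest_subset by blast
  next
    fix e assume "e \<in> X"
    then have "e \<in> E" using that F(1) by blast
    then show "e \<subseteq> V \<and> card e = 2" by (rule edge)
  qed (rule \<open>finite V\<close>)
  \<comment> \<open>Each \<open>F i \<inter> A\<close> is a spanning forest of \<open>A\<close>, as
    it has the same classes.\<close>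
  have rankA: "card (F i \<inter> A) + ?c = ?n" if "i < k" for i
    using rank[of "F i \<inter> A" i] A(3)[OF that] that by (simp add: components_def)
  have comp_ge1: "1 \<le> card (components V X)" if "V \<noteq> {}" for X
    using that \<open>finite V\<close> by (simp add: components_def Suc_le_eq card_gt_0_iff)
  have "(u, v) \<in> linked (F i)" if i: "i < k" and uv: "u \<in> V" "v \<in> V" for i u v
  proof -
    have V: "V \<noteq> {}" using uv by auto
    \<comment> \<open>The hypothesis \<open>cross\<close> is applied to the partition into classes
      of \<open>A\<close>, each vertex labelled by its class. No edge of \<open>A\<close> crosses
      it, so all crossing edges lie outside \<open>A\<close>, hence in some forest.\<close>
    have "{e \<in> E. \<exists>u \<in> e. \<exists>v \<in> e. linked A `` {u} \<noteq> linked A `` {v}} \<subseteq> E - A"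
    proof (intro subsetI DiffI notI)
      fix e assume e': "e \<in> {e \<in> E. \<exists>u \<in> e. \<exists>v \<in> e. linked A `` {u} \<noteq> linked A `` {v}}"
      then show "e \<in> E" by simp
      assume "e \<in> A"
      with e' obtain u v where e: "e \<in> A" "e \<in> E" "u \<in> e" "v \<in> e"
        and ne: "linked A `` {u} \<noteq> linked A `` {v}" by blast
      obtain a b where "e = {a, b}" using edge[OF e(2)] by (auto simp: card_2_iff)
      then have "u = v \<or> e = {u, v}" using e by auto
      then have "(u, v) \<in> linked A" using e(1) linked_edge[of u v A] by auto
      then show False using ne linked_class_eq[of A u v] by simp
    qed
    then have "k * (?c - 1) \<le> card (E - A)"
      using cross[of "\<lambda>v. linked A `` {v}"] card_mono[of "E - A"] finE
      unfolding components_def by (meson finite_Diff le_trans)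
    also have "card (E - A) \<le> card (\<Union>i<k. F i - A)"
      using A(2) finF by (intro card_mono) auto
    also have "\<dots> \<le> (\<Sum>i<k. card (F i - A))"
      by (rule card_UN_le) simp
    finally have le1: "(\<Sum>i<k. ?c - 1) \<le> (\<Sum>i<k. card (F i - A))" by simp
    \<comment> \<open>Edges outside and inside \<open>A\<close> add up to at least
      \<open>k * (?n - 1)\<close>. No forest has more than \<open>?n - 1\<close> edges, so each has
      exactly that many and is connected.\<close>
    have "?n - ?c \<le> card (F i \<inter> A)" if "i \<in> {..<k}" for i
      using rankA[of i] that by simp
    then have "(\<Sum>i<k. ?c - 1) + (\<Sum>i<k. ?n - ?c) \<le> (\<Sum>i<k. card (F i - A)) + (\<Sum>i<k. card (F i \<inter> A))"
      by (intro add_mono[OF le1] sum_mono)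
    also have "\<dots> = (\<Sum>i<k. card (F i))"
      unfolding sum.distrib[symmetric]
    proof (rule sum.cong)
      fix i assume "i \<in> {..<k}"
      then show "card (F i - A) + card (F i \<inter> A) = card (F i)"
        using finF[of i] card_Int_Diff[of "F i" A] by simp
    qed simp
    also have "(\<Sum>i<k. ?c - 1) + (\<Sum>i<k. ?n - ?c) = (\<Sum>i<k. ?n - 1)"
      unfolding sum.distrib[symmetric] using rankA[OF i] comp_ge1[OF V, of A] by simp
    finally have ge: "(\<Sum>i<k. ?n - 1) \<le> (\<Sum>i<k. card (F i))" .
    have le: "card (F j) \<le> ?n - 1" if "j \<in> {..<k}" for j
      using rank[of "F j" j] comp_ge1[OF V, of "F j"] that by simp
    have "card (F i) = ?n - 1"
    proof (rule ccontr)
      assume "card (F i) \<noteq> ?n - 1"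
      then have "card (F i) < ?n - 1" using le[of i] i by simp
      then have "(\<Sum>i<k. card (F i)) < (\<Sum>i<k. ?n - 1)"
        using le i by (intro sum_strict_mono_ex1) auto
      then show False using ge by simp
    qed
    then have "card (components V (F i)) = 1"
      using rank[of "F i" i] i comp_ge1[OF V, of "F i"] V \<open>finite V\<close> by (simp add: card_gt_0_iff)
    then obtain X where "components V (F i) = {X}" by (auto simp: card_1_singleton_iff)
    then have "linked (F i) `` {u} = X" "linked (F i) `` {v} = X"
      using uv by (auto simp only: components_def)
    then have "linked (F i) `` {u} = linked (F i) `` {v}" by simp
    then show ?thesis by (simp only: linked_class_eq)
  qed
  then show thesis using that[of F] F(1) dis by blast
qed

section \<open>Counting crossing edges\<close>

text \<open>Clearing denominators, the claim is \<open>k^2 \<le> (a - k) * (b - k)\<close>. With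
  \<open>a = k + 1 + p\<close> and \<open>b = k + 1 + q\<close> the product is
  \<open>p * q + p + q + 1\<close>, and the last hypothesis says
  \<open>k^2 \<le> p + q + 1\<close>.\<close>

lemma inverse_degree_sum_le:
  fixes a b k :: nat
  assumes "k + 1 \<le> a" and "k + 1 \<le> b" and "k^2 + 2 * k + 1 \<le> a + b"
  shows "real k / real a + real k / real b \<le> 1"
proof -
  obtain p q where p: "a = k + 1 + p" and q: "b = k + 1 + q"
    using assms(1,2) by (metis le_Suc_ex)
  have "k * k \<le> p + q + 1"
    using assms(3) p q by (simp add: power2_eq_square)
  then have "k * (a + b) \<le> a * b"
    unfolding p q by (simp add: algebra_simps)
  then have "real k * (real a + real b) \<le> real a * real b"
    by (metis of_nat_add of_nat_le_iff of_nat_mult)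
  moreover have "0 < real a" "0 < real b" using assms by auto
  ultimately show ?thesis by (simp add: field_simps)
qed

text \<open>Every crossing edge distributes a total weight of at most 1 to its ends, so that each part
  receives at least \<open>k\<close>: an end \<open>v\<close> gets \<open>1 / (k + 1)\<close> if its part contains an edge, and
  \<open>k / deg v\<close> otherwise.\<close>

lemma cross_edges_bound:
  fixes V :: "'a set" and E :: "'a set set" and c :: "'a \<Rightarrow> 'b" and k :: nat
  assumes k: "1 \<le> k" and "finite V" and edge: "\<And>e. e \<in> E \<Longrightarrow> e \<subseteq> V \<and> card e = 2"
    and deg: "\<And>v. v \<in> V \<Longrightarrow> k + 1 \<le> card {e \<in> E. v \<in> e}"
    and deg2: "\<And>u v. {u, v} \<in> E \<Longrightarrow> k^2 + 2 * k + 1 \<le> card {e \<in> E. u \<in> e} + card {e \<in> E. v \<in> e}"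
    and cut: "\<And>X. X \<subseteq> V \<Longrightarrow> \<exists>e \<in> E. e \<subseteq> X \<Longrightarrow> \<exists>e \<in> E. e \<subseteq> V - X \<Longrightarrow>
      k^2 + 2 * k - 1 \<le> card {e \<in> E. \<not> e \<subseteq> X \<and> \<not> e \<subseteq> V - X}"
  shows "k * (card (c ` V) - 1) \<le> card {e \<in> E. \<exists>u \<in> e. \<exists>v \<in> e. c u \<noteq> c v}"
proof -
  define d where "d v = card {e \<in> E. v \<in> e}" for v
  define part where "part b = {v \<in> V. c v = b}" for b
  define C where "C = {e \<in> E. \<exists>u \<in> e. \<exists>v \<in> e. c u \<noteq> c v}"
  have finE: "finite E" using edge \<open>finite V\<close> by (meson Pow_iff finite_Pow_iff finite_subset subsetI)
  then have finC: "finite C" by (simp add: C_def)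
  have "k * (card (c ` V) - 1) \<le> card C"
  \<comment> \<open>The hypothesis \<open>cut\<close> asks for an edge on both sides. A part that
    meets every edge is therefore treated first, by counting the edges at the vertices outside
    it.\<close>
  proof (cases "\<exists>b \<in> c ` V. \<forall>e \<in> E. \<not> e \<subseteq> V - part b")
    case True
    then obtain b where b: "b \<in> c ` V" "\<And>e. e \<in> E \<Longrightarrow> \<not> e \<subseteq> V - part b" by blast
    let ?W = "V - part b"
    have "c ` V = insert b (c ` ?W)" using b(1) by (auto simp: part_def)
    then have "card (c ` V) - 1 \<le> card (c ` ?W)"
      using \<open>finite V\<close> by (simp add: card_insert_if)
    also have "\<dots> \<le> card ?W" using \<open>finite V\<close> by (simp add: card_image_le)
    finally have "k * (card (c ` V) - 1) \<le> (k + 1) * card ?W"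
      by (metis le_add1 mult_le_mono)
    also have "\<dots> = (\<Sum>v\<in>?W. k + 1)" by simp
    also have "\<dots> \<le> (\<Sum>v\<in>?W. card {e \<in> E. v \<in> e})"
      using deg by (intro sum_mono) auto
    \<comment> \<open>Every edge has an end in the part \<open>b\<close>, hence at most one end in
      \<open>?W\<close>, so the stars are disjoint.\<close>
    also have "\<dots> = card (\<Union>v\<in>?W. {e \<in> E. v \<in> e})"
    proof (rule card_UN_disjoint[symmetric])
      show "\<forall>u\<in>?W. \<forall>v\<in>?W. u \<noteq> v \<longrightarrow> {e \<in> E. u \<in> e} \<inter> {e \<in> E. v \<in> e} = {}"
      proof (intro ballI impI equals0I)
        fix u v e assume uv: "u \<in> ?W" "v \<in> ?W" "u \<noteq> v" and e: "e \<in> {e \<in> E. u \<in> e} \<inter> {e \<in> E. v \<in> e}"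
        then obtain x y where "e = {x, y}" using edge[of e] by (auto simp: card_2_iff)
        then have "e = {u, v}" using uv e by auto
        then show False using b(2)[of e] uv e by auto
      qed
    qed (use \<open>finite V\<close> finE in auto)
    also have "\<dots> \<le> card C"
    proof (rule card_mono[OF finC], rule subsetI)
      fix e assume "e \<in> (\<Union>v\<in>?W. {e \<in> E. v \<in> e})"
      then obtain v where v: "v \<in> V" "c v \<noteq> b" "v \<in> e" "e \<in> E" by (auto simp: part_def)
      moreover obtain u where "u \<in> e" "c u = b" using b(2)[OF v(4)] edge[OF v(4)] by (auto simp: part_def)
      ultimately show "e \<in> C" unfolding C_def by blast
    qed
    finally show ?thesis .
  next
    case False
    define big where "big v \<longleftrightarrow> (\<exists>e \<in> E. e \<subseteq> part (c v))" for v
    define w where "w v = (if big v then 1 / (real k + 1) else real k / real (d v))" for v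
    have d_ge: "k + 1 \<le> d v" if "v \<in> V" for v using deg[OF that] by (simp add: d_def)
    have w_nonneg: "0 \<le> w v" for v by (simp add: w_def)
    have w_le: "w v \<le> real k / (real k + 1)" if "v \<in> V" for v
    proof (cases "big v")
      case True
      then show ?thesis using k by (simp add: w_def divide_right_mono)
    next
      case False
      have "real k + 1 \<le> real (d v)" using d_ge[OF that] by linarith
      then show ?thesis using False by (simp add: w_def frac_le)
    qed
    have w_edge: "(\<Sum>v\<in>e. w v) \<le> 1" if "e \<in> C" for e
    proof -
      have e: "e \<in> E" "e \<subseteq> V" "card e = 2" using that edge by (auto simp: C_def)
      then obtain u v where uv: "e = {u, v}" "u \<noteq> v" by (auto simp: card_2_iff)
      have V: "u \<in> V" "v \<in> V" using uv e by auto
      have one: "1 / (real k + 1) + real k / (real k + 1) = 1"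
        by (simp add: add_divide_distrib[symmetric] add.commute)
      \<comment> \<open>If one end is big, it gets \<open>1 / (k + 1)\<close> and the other at most
        \<open>k / (k + 1)\<close>; if neither is, the degree sum bounds the weights.\<close>
      have "w u + w v \<le> 1"
      proof (cases "big u \<or> big v")
        case True
        then show ?thesis using w_le[OF V(1)] w_le[OF V(2)] one by (auto simp: w_def)
      next
        case False
        then show ?thesis
          using inverse_degree_sum_le[OF d_ge[OF V(1)] d_ge[OF V(2)]] deg2[of u v] e(1) uv
          by (simp add: w_def d_def)
      qed
      then show ?thesis using uv by simp
    qed
    have part_ge: "real k \<le> (\<Sum>v\<in>{v \<in> V. c v = b}. w v * real (card {e \<in> C. v \<in> e}))"
      if b: "b \<in> c ` V" for b
    proof -
      have fp: "finite (part b)" using \<open>finite V\<close> by (simp add: part_def)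
      have "real k \<le> (\<Sum>v\<in>part b. w v * real (card {e \<in> C. v \<in> e}))"
      proof (cases "\<exists>e \<in> E. e \<subseteq> part b")
        case True
        let ?K = "{e \<in> E. \<not> e \<subseteq> part b \<and> \<not> e \<subseteq> V - part b}"
        \<comment> \<open>At least \<open>k * (k + 1)\<close> edges leave the part, and each gives
          \<open>1 / (k + 1)\<close> to its end inside. An edge avoiding the part exists by the
          outer case distinction.\<close>
        have "k * (k + 1) \<le> k^2 + 2 * k - 1" using k by (simp add: power2_eq_square)
        also have "\<dots> \<le> card ?K"
          using True \<open>\<not> (\<exists>b \<in> c ` V. _ b)\<close> b by (intro cut) (auto simp: part_def)
        also have "\<dots> \<le> card (\<Union>v\<in>part b. {e \<in> C. v \<in> e})"
        proof (rule card_mono, use fp finC in simp, rule subsetI)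
          fix e assume e: "e \<in> ?K"
          then have "e \<subseteq> V" using edge by auto
          then obtain u v where "u \<in> e" "c u \<noteq> b" "v \<in> e" "v \<in> part b"
            using e unfolding part_def by blast
          moreover from this have "e \<in> C" using e unfolding C_def part_def by auto
          ultimately show "e \<in> (\<Union>v\<in>part b. {e \<in> C. v \<in> e})" by blast
        qed
        also have "\<dots> \<le> (\<Sum>v\<in>part b. card {e \<in> C. v \<in> e})"
          using fp by (rule card_UN_le)
        finally have "real (k * (k + 1)) \<le> real (\<Sum>v\<in>part b. card {e \<in> C. v \<in> e})"
          by (simp only: of_nat_le_iff)
        then have "real k \<le> (\<Sum>v\<in>part b. real (card {e \<in> C. v \<in> e})) / (real k + 1)"
          by (simp add: pos_le_divide_eq algebra_simps)
        also have "\<dots> = (\<Sum>v\<in>part b. w v * real (card {e \<in> C. v \<in> e}))"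
          unfolding sum_divide_distrib
          by (rule sum.cong) (use True in \<open>auto simp: w_def big_def part_def\<close>)
        finally show ?thesis .
      next
        case False
        obtain v where v: "v \<in> V" "c v = b" using b by auto
        then have vp: "v \<in> part b" by (simp add: part_def)
        \<comment> \<open>With no edge inside the part, all edges at \<open>v\<close> cross, so
          \<open>v\<close> alone receives \<open>d v\<close> times \<open>k / d v\<close>.\<close>
        have "{e \<in> C. v \<in> e} = {e \<in> E. v \<in> e}"
        proof (intro equalityI subsetI)
          fix e assume e: "e \<in> {e \<in> E. v \<in> e}"
          then obtain u where "u \<in> e" "c u \<noteq> b" using False edge[of e] by (auto simp: part_def)
          then show "e \<in> {e \<in> C. v \<in> e}" using e v unfolding C_def by blast
        qed (auto simp: C_def)
        then have "w v * real (card {e \<in> C. v \<in> e}) = real k"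
          using False v d_ge[OF v(1)] by (simp add: w_def big_def d_def)
        then show ?thesis
          using member_le_sum[OF vp, of "\<lambda>v. w v * real (card {e \<in> C. v \<in> e})"] fp w_nonneg by simp
      qed
      then show ?thesis by (simp add: part_def)
    qed
    \<comment> \<open>Double counting of the weights: at least \<open>k\<close> for each part, at
      most 1 from each crossing edge.\<close>
    have "real k * real (card (c ` V)) = (\<Sum>b\<in>c ` V. real k)" by simp
    also have "\<dots> \<le> (\<Sum>b\<in>c ` V. \<Sum>v\<in>{v \<in> V. c v = b}. w v * real (card {e \<in> C. v \<in> e}))"
      using part_ge by (rule sum_mono)
    also have "\<dots> = (\<Sum>v\<in>V. w v * real (card {e \<in> C. v \<in> e}))"
      using \<open>finite V\<close> by (rule sum.image_gen[symmetric])
    also have "\<dots> = (\<Sum>v\<in>V. \<Sum>e\<in>C. if v \<in> e then w v else 0)"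
      using finC by (simp add: sum.inter_filter[symmetric] mult.commute)
    also have "\<dots> = (\<Sum>e\<in>C. \<Sum>v\<in>V. if v \<in> e then w v else 0)"
      by (rule sum.swap)
    also have "\<dots> = (\<Sum>e\<in>C. \<Sum>v\<in>e. w v)"
    proof (rule sum.cong)
      fix e assume "e \<in> C"
      then have "{v \<in> V. v \<in> e} = e" using edge by (auto simp: C_def)
      then show "(\<Sum>v\<in>V. if v \<in> e then w v else 0) = (\<Sum>v\<in>e. w v)"
        using \<open>finite V\<close> by (simp add: sum.inter_filter[symmetric])
    qed simp
    also have "\<dots> \<le> (\<Sum>e\<in>C. 1)" using w_edge by (rule sum_mono)
    finally have "real (k * card (c ` V)) \<le> real (card C)" by simp
    then have "k * card (c ` V) \<le> card C" by (simp only: of_nat_le_iff)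
    moreover have "k * (card (c ` V) - 1) \<le> k * card (c ` V)" by simp
    ultimately show ?thesis by (rule le_trans[rotated])
  qed
  then show ?thesis by (simp add: C_def)
qed

section \<open>Paths and trees\<close>

lemma path_edges_singleton [simp]: "path_edges [x] = {}"
  by (simp add: path_edges_def)

lemma path_edges_Cons [simp]: "path_edges (x # y # p) = insert {x, y} (path_edges (y # p))"
proof -
  have "e \<in> path_edges (x # y # p) \<longleftrightarrow> e = {x, y} \<or> e \<in> path_edges (y # p)" for e
  proof
    assume "e \<in> path_edges (x # y # p)"
    then obtain i where i: "Suc i < length (x # y # p)" "e = {(x # y # p) ! i, (x # y # p) ! Suc i}"
      unfolding path_edges_def by blast
    then show "e = {x, y} \<or> e \<in> path_edges (y # p)"
      by (cases i) (auto simp: path_edges_def)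
  next
    assume "e = {x, y} \<or> e \<in> path_edges (y # p)"
    then show "e \<in> path_edges (x # y # p)"
    proof
      assume "e = {x, y}"
      then show ?thesis unfolding path_edges_def by (intro CollectI exI[of _ 0]) simp
    next
      assume "e \<in> path_edges (y # p)"
      then obtain i where "Suc i < length (y # p)" "e = {(y # p) ! i, (y # p) ! Suc i}"
        unfolding path_edges_def by blast
      then show ?thesis unfolding path_edges_def by (intro CollectI exI[of _ "Suc i"]) simp
    qed
  qed
  then show ?thesis by auto
qed

lemma path_edges_linked:
  "p \<noteq> [] \<Longrightarrow> path_edges p \<subseteq> F \<Longrightarrow> (hd p, last p) \<in> linked F"
proof (induction p rule: induct_list012)
  case (3 x y p)
  then have "(x, y) \<in> linked F" "(y, last (y # p)) \<in> linked F"
    by (auto intro: linked_edge)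
  then show ?case using linked_trans[of x y F] by simp
qed auto

lemma path_edges_suffix: "q \<noteq> [] \<Longrightarrow> path_edges q \<subseteq> path_edges (p @ q)"
proof (induction p)
  case (Cons x p)
  then obtain y r where "p @ q = y # r" by (cases "p @ q") auto
  then show ?case using Cons by auto
qed simp

lemma set_subset_path_edges: "set p \<subseteq> insert (hd p) (\<Union>(path_edges p))"
  by (induction p rule: induct_list012) auto

text \<open>If the vertex to be prepended already lies on the path, the suffix starting there is
  taken instead, which keeps the vertices distinct.\<close>

lemma linked_imp_path:
  assumes "(u, v) \<in> linked F"
  obtains p where "p \<noteq> []" "distinct p" "path_edges p \<subseteq> F" "hd p = u" "last p = v"
proof -
  have "\<exists>p. p \<noteq> [] \<and> distinct p \<and> path_edges p \<subseteq> F \<and> hd p = u \<and> last p = v"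
    using assms unfolding linked_def
  proof (induction rule: converse_rtrancl_induct)
    case base
    show ?case by (intro exI[of _ "[v]"]) simp
  next
    case (step x y)
    then obtain p where p: "p \<noteq> []" "distinct p" "path_edges p \<subseteq> F" "hd p = y" "last p = v" by blast
    show ?case
    proof (cases "x \<in> set p")
      case True
      then obtain ys zs where eq: "p = ys @ x # zs" by (meson split_list)
      then have "path_edges (x # zs) \<subseteq> F" using p(3) path_edges_suffix[of "x # zs" ys] by auto
      then show ?thesis using p eq by (intro exI[of _ "x # zs"]) auto
    next
      case False
      obtain p' where "p = y # p'" using p by (cases p) auto
      then show ?thesis using p False step(1) by (intro exI[of _ "x # p"]) (auto simp: adjacency_def)
    qed
  qed
  then show thesis using that by blast
qed

text \<open>First and last position are not consecutive on three or more vertices. Hence deleting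
  the closing edge of a cycle leaves its path intact.\<close>

lemma closing_edge_notin_path_edges:
  assumes "distinct p" and "3 \<le> length p"
  shows "{last p, hd p} \<notin> path_edges p"
proof
  assume "{last p, hd p} \<in> path_edges p"
  then obtain i where i: "Suc i < length p" "{last p, hd p} = {p ! i, p ! Suc i}"
    unfolding path_edges_def by blast
  have "p \<noteq> []" using assms(2) by auto
  then have "hd p = p ! 0" "last p = p ! (length p - 1)"
    by (auto simp: hd_conv_nth last_conv_nth)
  then have "p ! 0 = p ! i \<and> p ! (length p - 1) = p ! Suc i \<or> p ! 0 = p ! Suc i"
    using i(2) by (auto simp: doubleton_eq_iff)
  then show False
  proof
    assume "p ! 0 = p ! i \<and> p ! (length p - 1) = p ! Suc i"
    then have "0 = i" "length p - 1 = Suc i"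
      using i(1) assms \<open>p \<noteq> []\<close> nth_eq_iff_index_eq[OF assms(1), of 0 i]
        nth_eq_iff_index_eq[OF assms(1), of "length p - 1" "Suc i"] by simp_all
    then show False using assms(2) by simp
  next
    assume "p ! 0 = p ! Suc i"
    then show False using i(1) \<open>p \<noteq> []\<close> nth_eq_iff_index_eq[OF assms(1), of 0 "Suc i"] by simp
  qed
qed

lemma inner_vertex_path_edges:
  assumes "distinct p" and "w \<in> set p" and "w \<noteq> hd p" and "w \<noteq> last p"
  obtains a b where "a \<noteq> b" and "{a, w} \<in> path_edges p" and "{w, b} \<in> path_edges p"
proof -
  obtain m where m: "m < length p" "w = p ! m" using assms(2) by (auto simp: in_set_conv_nth)
  have "p \<noteq> []" using assms(2) by auto
  then have "m \<noteq> 0" "m \<noteq> length p - 1"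
    using assms(3,4) m by (metis hd_conv_nth, metis last_conv_nth)
  then obtain l where l: "m = Suc l" "Suc m < length p" using m by (cases m) auto
  show thesis
  proof
    show "p ! l \<noteq> p ! Suc m" using assms(1) l by (simp add: nth_eq_iff_index_eq)
    show "{p ! l, w} \<in> path_edges p" "{w, p ! Suc m} \<in> path_edges p"
      using l m unfolding path_edges_def by auto
  qed
qed

text \<open>A minimal connecting subset of \<open>H\<close> has no cycle, since the closing edge of
  a cycle could be removed.\<close>

lemma linked_contains_tree:
  assumes "finite W" and "W \<noteq> {}" and edge: "\<And>e. e \<in> H \<Longrightarrow> e \<subseteq> W \<and> card e = 2"
    and conn: "\<And>u v. u \<in> W \<Longrightarrow> v \<in> W \<Longrightarrow> (u, v) \<in> linked H"
  obtains T where "T \<subseteq> H" and "is_tree \<lparr>verts = W, edges = T\<rparr>"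
proof -
  let ?S = "{T. T \<subseteq> H \<and> (\<forall>u \<in> W. \<forall>v \<in> W. (u, v) \<in> linked T)}"
  have "finite H" using edge \<open>finite W\<close> by (meson Pow_iff finite_Pow_iff finite_subset subsetI)
  then have "finite ?S" by simp
  moreover have "H \<in> ?S" using conn by simp
  ultimately obtain T where T: "T \<in> ?S" and min: "\<And>N. N \<in> ?S \<Longrightarrow> N \<subseteq> T \<Longrightarrow> T = N"
    using finite_has_minimal[of ?S] by (metis (no_types, lifting) empty_iff)
  have nocycle: "\<not> is_cycle \<lparr>verts = W, edges = T\<rparr> p" for p
  proof
    assume "is_cycle \<lparr>verts = W, edges = T\<rparr> p"
    then have p: "p \<noteq> []" "distinct p" "path_edges p \<subseteq> T" "3 \<le> length p" "{last p, hd p} \<in> T"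
      by (auto simp: is_cycle_def is_path_def)
    let ?e = "{last p, hd p}"
    have "path_edges p \<subseteq> T - {?e}"
      using closing_edge_notin_path_edges[OF p(2,4)] p(3) by auto
    then have "(hd p, last p) \<in> linked (T - {?e})"
      using p(1) by (intro path_edges_linked)
    then have "linked (insert ?e (T - {?e})) = linked (T - {?e})"
      by (rule linked_insert_redundant[OF linked_sym])
    then have "linked (T - {?e}) = linked T" using p(5) by (simp add: insert_absorb)
    then have "T - {?e} \<in> ?S" using T by auto
    then show False using min[of "T - {?e}"] p(5) by auto
  qed
  have "connected_graph \<lparr>verts = W, edges = T\<rparr>"
    unfolding connected_graph_def
  proof (intro conjI ballI)
    fix u v assume "u \<in> verts \<lparr>verts = W, edges = T\<rparr>" "v \<in> verts \<lparr>verts = W, edges = T\<rparr>"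
    then have uv: "u \<in> W" "(u, v) \<in> linked T" using T by auto
    obtain p where p: "p \<noteq> []" "distinct p" "path_edges p \<subseteq> T" "hd p = u" "last p = v"
      using linked_imp_path[OF uv(2)] .
    have "\<Union>(path_edges p) \<subseteq> W" using p(3) T edge by blast
    then have "set p \<subseteq> W" using set_subset_path_edges[of p] p(4) uv(1) by blast
    then show "\<exists>p. path_between \<lparr>verts = W, edges = T\<rparr> u v p"
      using p by (intro exI[of _ p]) (simp add: path_between_def is_path_def)
  qed (simp add: \<open>W \<noteq> {}\<close>)
  moreover have "simple_graph \<lparr>verts = W, edges = T\<rparr>"
    using T edge \<open>finite W\<close> unfolding simple_graph_def by (simp, meson subsetD)
  ultimately have "is_tree \<lparr>verts = W, edges = T\<rparr>"
    using nocycle by (simp add: is_tree_def)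
  then show thesis using T that by blast
qed

text \<open>Trees are chosen inside the \<open>H i\<close>. A common vertex of two paths other than
  \<open>u\<close> and \<open>v\<close> has two neighbours on each of them, so it would lie in both
  \<open>C i\<close> and \<open>C j\<close>.\<close>

lemma completely_independent_if_edge_sets:
  assumes "simple_graph L" and "verts L \<noteq> {}"
    and sub: "\<And>i. i < k \<Longrightarrow> H i \<subseteq> edges L"
    and conn: "\<And>i u v. i < k \<Longrightarrow> u \<in> verts L \<Longrightarrow> v \<in> verts L \<Longrightarrow> (u, v) \<in> linked (H i)"
    and disj: "\<And>i j. i < k \<Longrightarrow> j < k \<Longrightarrow> i \<noteq> j \<Longrightarrow> H i \<inter> H j = {}"
    and inner: "\<And>i a w b. i < k \<Longrightarrow> {a, w} \<in> H i \<Longrightarrow> {w, b} \<in> H i \<Longrightarrow> a \<noteq> b \<Longrightarrow> w \<in> C i"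
    and inner_disj: "\<And>i j. i < k \<Longrightarrow> j < k \<Longrightarrow> i \<noteq> j \<Longrightarrow> C i \<inter> C j = {}"
  shows "has_completely_independent_spanning_trees L k"
proof -
  have "\<exists>T. T \<subseteq> H i \<and> is_tree \<lparr>verts = verts L, edges = T\<rparr>" if i: "i < k" for i
  proof -
    have "e \<subseteq> verts L \<and> card e = 2" if "e \<in> H i" for e
      using that sub[OF i] assms(1) by (auto simp: simple_graph_def)
    then obtain T where "T \<subseteq> H i" "is_tree \<lparr>verts = verts L, edges = T\<rparr>"
      using linked_contains_tree[of "verts L" "H i"] assms(1,2) conn[OF i]
      unfolding simple_graph_def by metis
    then show ?thesis by blast
  qed
  then obtain T where T: "\<And>i. i < k \<Longrightarrow> T i \<subseteq> H i \<and> is_tree \<lparr>verts = verts L, edges = T i\<rparr>"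
    by metis
  let ?T = "\<lambda>i. \<lparr>verts = verts L, edges = T i\<rparr>"
  have "path_edges p \<inter> path_edges q = {} \<and> set p \<inter> set q \<subseteq> {u, v}"
    if ij: "i < k" "j < k" "i \<noteq> j" and p: "path_between (?T i) u v p" and q: "path_between (?T j) u v q"
    for i j u v p q
  proof
    have pH: "distinct p" "path_edges p \<subseteq> H i" "hd p = u" "last p = v"
      using p T[OF ij(1)] by (auto simp: path_between_def is_path_def)
    have qH: "distinct q" "path_edges q \<subseteq> H j" "hd q = u" "last q = v"
      using q T[OF ij(2)] by (auto simp: path_between_def is_path_def)
    show "path_edges p \<inter> path_edges q = {}" using pH(2) qH(2) disj[OF ij] by blast
    show "set p \<inter> set q \<subseteq> {u, v}"
    proof (rule subsetI, rule ccontr)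
      fix w assume w: "w \<in> set p \<inter> set q" "w \<notin> {u, v}"
      obtain a b where "a \<noteq> b" "{a, w} \<in> path_edges p" "{w, b} \<in> path_edges p"
        using inner_vertex_path_edges[of p w] pH w by auto
      then have "w \<in> C i" using inner[OF ij(1)] pH(2) by blast
      moreover obtain a b where "a \<noteq> b" "{a, w} \<in> path_edges q" "{w, b} \<in> path_edges q"
        using inner_vertex_path_edges[of q w] qH w by auto
      then have "w \<in> C j" using inner[OF ij(2)] qH(2) by blast
      ultimately show False using inner_disj[OF ij] by blast
    qed
  qed
  moreover have "spanning_tree L (?T i)" if "i < k" for i
    using T[OF that] sub[OF that] by (auto simp: spanning_tree_def)
  ultimately have "completely_independent L k ?T"
    unfolding completely_independent_def by blast
  then show ?thesis unfolding has_completely_independent_spanning_trees_def by blast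
qed

section \<open>Line graphs\<close>

text \<open>Here \<open>d\<close> is the distance from \<open>r\<close> and \<open>par v\<close> the
  last vertex before \<open>v\<close> on a shortest walk from \<open>r\<close>.\<close>

lemma linked_rooted:
  assumes "\<And>v. v \<in> V \<Longrightarrow> (r, v) \<in> linked F"
  obtains par :: "'a \<Rightarrow> 'a" and d :: "'a \<Rightarrow> nat"
    where "\<And>v. v \<in> V \<Longrightarrow> v \<noteq> r \<Longrightarrow> {v, par v} \<in> F" and "\<And>v. v \<in> V \<Longrightarrow> v \<noteq> r \<Longrightarrow> d (par v) < d v"
proof -
  define d where "d v = (LEAST n. (r, v) \<in> adjacency F ^^ n)" for v
  have "\<exists>u. {v, u} \<in> F \<and> d u < d v" if v: "v \<in> V" "v \<noteq> r" for v
  proof -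
    obtain n where "(r, v) \<in> adjacency F ^^ n"
      using assms[OF v(1)] unfolding linked_def by (meson rtrancl_imp_relpow)
    then have dv: "(r, v) \<in> adjacency F ^^ d v" unfolding d_def by (rule LeastI)
    then obtain m where m: "d v = Suc m" using v(2) by (cases "d v") auto
    then obtain u where u: "(r, u) \<in> adjacency F ^^ m" "(u, v) \<in> adjacency F"
      using dv by auto
    have "d u \<le> m" unfolding d_def using u(1) by (rule Least_le)
    then show ?thesis using u(2) m by (auto simp: adjacency_def insert_commute)
  qed
  then obtain par where "\<And>v. v \<in> V \<Longrightarrow> v \<noteq> r \<Longrightarrow> {v, par v} \<in> F \<and> d (par v) < d v" by metis
  then show thesis using that by blast
qed

lemma simple_graph_line_graph:
  fixes G :: "'a ugraph"
  assumes "simple_graph G"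
  shows "simple_graph (line_graph G)"
proof -
  have "finite (Pow (verts G))" and "edges G \<subseteq> Pow (verts G)"
    using assms by (auto simp: simple_graph_def)
  then have "finite (edges G)" by (rule finite_subset[rotated])
  moreover have "a \<subseteq> edges G \<and> card a = 2" if a: "a \<in> edges (line_graph G)" for a
  proof -
    obtain e f where "a = {e, f}" "e \<in> edges G" "f \<in> edges G" "e \<noteq> f"
      using a unfolding line_graph_def by auto
    then show ?thesis by simp
  qed
  ultimately show ?thesis by (simp add: simple_graph_def line_graph_def)
qed

text \<open>Root all the sets \<open>F i\<close> at a common vertex \<open>r\<close>. Outside \<open>F i\<close> an edge \<open>e\<close> of \<open>G\<close> is attached to
  the parent edge in \<open>F i\<close> of an end \<open>x e \<noteq> r\<close>. If \<open>e\<close> is itself the parent edge of a vertex \<open>v\<close>, then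
  \<open>x e\<close> is the parent of \<open>v\<close> unless that is \<open>r\<close>; this prevents two edges from being attached to each
  other.\<close>

lemma line_graph_completely_independent:
  fixes G :: "'a ugraph"
  assumes G: "simple_graph G" and ne: "edges G \<noteq> {}"
    and sub: "\<And>i. i < k \<Longrightarrow> F i \<subseteq> edges G"
    and disj: "\<And>i j. i < k \<Longrightarrow> j < k \<Longrightarrow> i \<noteq> j \<Longrightarrow> F i \<inter> F j = {}"
    and conn: "\<And>i u v. i < k \<Longrightarrow> u \<in> verts G \<Longrightarrow> v \<in> verts G \<Longrightarrow> (u, v) \<in> linked (F i)"
  shows "has_completely_independent_spanning_trees (line_graph G) k"
proof -
  let ?V = "verts G" and ?E = "edges G"
  have edge: "e \<subseteq> ?V" "card e = 2" if "e \<in> ?E" for e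
    using G that by (auto simp: simple_graph_def)
  have edge_eq: "e = {a, b}" if "e \<in> ?E" "a \<in> e" "b \<in> e" "a \<noteq> b" for e a b
    using edge(2)[OF that(1)] that(2-4) by (auto simp: card_2_iff)
  obtain r s where rs: "{r, s} \<in> ?E" "r \<noteq> s"
    using ne edge(2) by (metis card_2_iff ex_in_conv)
  then have r: "r \<in> ?V" and s: "s \<in> ?V" using edge(1) by auto
  have "\<exists>par d. \<forall>v\<in>?V. v \<noteq> r \<longrightarrow> {v, par v} \<in> F i \<and> d (par v) < (d v :: nat)" if "i < k" for i
    using linked_rooted[of ?V r "F i"] conn[OF that r] by metis
  then obtain par and d :: "nat \<Rightarrow> 'a \<Rightarrow> nat" where
    par: "\<And>i v. i < k \<Longrightarrow> v \<in> ?V \<Longrightarrow> v \<noteq> r \<Longrightarrow> {v, par i v} \<in> F i" and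
    d: "\<And>i v. i < k \<Longrightarrow> v \<in> ?V \<Longrightarrow> v \<noteq> r \<Longrightarrow> d i (par i v) < d i v"
    by metis
  have "\<exists>x. x \<in> e \<and> x \<noteq> r \<and> (\<forall>i<k. e = {x, par i x} \<longrightarrow> par i x = r)" if e: "e \<in> ?E" for e
  proof (cases "\<exists>i<k. \<exists>v\<in>?V. v \<noteq> r \<and> e = {v, par i v} \<and> par i v \<noteq> r")
    case True
    then obtain i v where i: "i < k" and v: "v \<in> ?V" "v \<noteq> r" "e = {v, par i v}" "par i v \<noteq> r"
      by blast
    let ?x = "par i v"
    have x: "?x \<in> ?V" "v \<noteq> ?x" using v e edge(1) d[OF i v(1,2)] by auto
    \<comment> \<open>Were \<open>e\<close> also the parent edge of \<open>?x\<close> in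
      \<open>F j\<close>, disjointness would give \<open>j = i\<close>, and \<open>v\<close> and
      \<open>?x\<close> would be parents of each other, although \<open>d i\<close> decreases
      towards the root.\<close>
    have "e \<noteq> {?x, par j ?x}" if j: "j < k" for j
    proof
      assume eq: "e = {?x, par j ?x}"
      have "e \<in> F i" "e \<in> F j" using par[OF i v(1,2)] par[OF j x(1) v(4)] v(3) eq by auto
      then have "j = i" using disj[OF i j] by blast
      then have "par i ?x = v" using eq v(3) x(2) by (metis doubleton_eq_iff)
      then show False using d[OF i v(1,2)] d[OF i x(1) v(4)] by simp
    qed
    then show ?thesis using v by blast
  next
    case False
    obtain x where x: "x \<in> e" "x \<noteq> r"
      using edge(2)[OF e] by (metis card_2_iff insertCI)
    then show ?thesis using False edge(1)[OF e] by blast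
  qed
  then obtain x where x: "\<And>e. e \<in> ?E \<Longrightarrow> x e \<in> e" "\<And>e. e \<in> ?E \<Longrightarrow> x e \<noteq> r"
    "\<And>e i. e \<in> ?E \<Longrightarrow> i < k \<Longrightarrow> e = {x e, par i (x e)} \<Longrightarrow> par i (x e) = r"
    by metis
  have xV: "x e \<in> ?V" if "e \<in> ?E" for e using x(1)[OF that] edge(1)[OF that] by blast
  define P where "P i e = {x e, par i (x e)}" for i e
  have P: "P i e \<in> F i" if "i < k" "e \<in> ?E" for i e
    using par[OF that(1) xV[OF that(2)] x(2)[OF that(2)]] by (simp add: P_def)
  define H where "H i = {{e, f} | e f. e \<in> F i \<and> f \<in> F i \<and> e \<noteq> f \<and> e \<inter> f \<noteq> {}}
    \<union> {{e, P i e} | e. e \<in> ?E - F i}" for i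
  \<comment> \<open>Edges of \<open>G\<close> outside \<open>F i\<close> are leaves of
    \<open>H i\<close>. This serves both the disjointness of the \<open>H i\<close> and the location
    of inner vertices.\<close>
  have H_attach: "b = P i a" if "i < k" "{a, b} \<in> H i" "a \<notin> F i" for i a b
    using that P[OF that(1)] unfolding H_def by (auto simp: doubleton_eq_iff)
  have H_meets: "a \<in> F i \<or> b \<in> F i" if "i < k" "{a, b} \<in> H i" for i a b
    using that P[OF that(1)] unfolding H_def by (auto simp: doubleton_eq_iff)
  have H_sub: "H i \<subseteq> edges (line_graph G)" if i: "i < k" for i
  proof
    fix a assume "a \<in> H i"
    then consider e f where "a = {e, f}" "e \<in> F i" "f \<in> F i" "e \<noteq> f" "e \<inter> f \<noteq> {}"
      | e where "a = {e, P i e}" "e \<in> ?E" "e \<notin> F i"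
      unfolding H_def by blast
    then show "a \<in> edges (line_graph G)"
    proof cases
      case 1
      then show ?thesis using sub[OF i] unfolding line_graph_def by auto
    next
      case 2
      then have "P i e \<in> ?E" "e \<noteq> P i e" using P[OF i, of e] sub[OF i] by (blast, metis)
      moreover have "e \<inter> P i e \<noteq> {}" using x(1)[OF 2(2)] by (auto simp: P_def)
      ultimately show ?thesis using 2 unfolding line_graph_def by auto
    qed
  qed
  show ?thesis
  proof (rule completely_independent_if_edge_sets[where H = H and C = F])
    show "simple_graph (line_graph G)" using G by (rule simple_graph_line_graph)
    show "verts (line_graph G) \<noteq> {}" using ne by (simp add: line_graph_def)
  next
    fix i e f assume i: "i < k" and ef: "e \<in> verts (line_graph G)" "f \<in> verts (line_graph G)"
    \<comment> \<open>A walk in \<open>F i\<close> from \<open>r\<close> to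
      \<open>s \<noteq> r\<close> starts with an edge at the root; all other edges are linked to
      this one.\<close>
    obtain t where t: "{r, t} \<in> F i"
      using conn[OF i r s] rs(2) unfolding linked_def
      by (metis adjacency_def case_prodD converse_rtranclE mem_Collect_eq)
    have adj: "(a, b) \<in> linked (H i)" if "a \<in> F i" "b \<in> F i" "v \<in> a" "v \<in> b" for a b v
    proof (cases "a = b")
      case False
      then have "{a, b} \<in> H i" using that unfolding H_def by blast
      then show ?thesis by (rule linked_edge)
    qed simp
    \<comment> \<open>Climbing to the root: an edge at \<open>v\<close> meets the parent edge of
      \<open>v\<close>, whose other end has smaller \<open>d i\<close>.\<close>
    have inF: "(a, {r, t}) \<in> linked (H i)" if "v \<in> a" "a \<in> F i" for v a
      using that
    proof (induction "d i v" arbitrary: v a rule: less_induct)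
      case less
      show ?case
      proof (cases "v = r")
        case True
        then show ?thesis using adj[of a "{r, t}" r] less.prems t by simp
      next
        case False
        have v: "v \<in> ?V" using less.prems sub[OF i] edge(1) by blast
        let ?b = "{v, par i v}"
        have b: "?b \<in> F i" "d i (par i v) < d i v" using par[OF i v False] d[OF i v False] by auto
        then have "(?b, {r, t}) \<in> linked (H i)" using less.hyps[of "par i v" ?b] by simp
        moreover have "(a, ?b) \<in> linked (H i)" using adj[of a ?b v] less.prems b by simp
        ultimately show ?thesis using linked_trans by metis
      qed
    qed
    have all: "(a, {r, t}) \<in> linked (H i)" if a: "a \<in> ?E" for a
    proof (cases "a \<in> F i")
      case True
      then show ?thesis using inF[OF x(1)[OF a]] by simp
    next
      case False
      then have "{a, P i a} \<in> H i" using a unfolding H_def by blast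
      then have "(a, P i a) \<in> linked (H i)" by (rule linked_edge)
      moreover have "(P i a, {r, t}) \<in> linked (H i)"
        using inF[of "x a" "P i a"] P[OF i a] by (simp add: P_def)
      ultimately show ?thesis by (rule linked_trans)
    qed
    show "(e, f) \<in> linked (H i)"
      using ef by (intro linked_trans[OF all linked_sym[OF all]]) (simp_all add: line_graph_def)
  next
    fix i j assume ij: "i < k" "j < k" "i \<noteq> j"
    show "H i \<inter> H j = {}"
    proof (rule equals0I)
      fix a assume a: "a \<in> H i \<inter> H j"
      then have "a \<in> H i" by simp
      then obtain e f where ef: "a = {e, f}" unfolding H_def by blast
      \<comment> \<open>Here \<open>e\<close> and \<open>f\<close> are attached to each other. If
        \<open>x e \<noteq> x f\<close>, both equal \<open>{x e, x f}\<close>. If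
        \<open>x e = x f\<close>, both are parent edges of this vertex, so by the choice of
        \<open>x\<close> both parents are \<open>r\<close>, and again \<open>e = f\<close>.\<close>
      have hyp: False
        if ef: "{e, f} \<in> H i" "{e, f} \<in> H j" "e \<in> F i" "f \<in> F j" for e f
      proof -
        have nin: "f \<notin> F i" "e \<notin> F j" using ef(3,4) disj[OF ij] by auto
        have E: "e \<in> ?E" "f \<in> ?E" using ef sub ij by auto
        have e: "e = P i f" using H_attach[OF ij(1), of f e] ef(1) nin by (simp add: insert_commute)
        have f: "f = P j e" using H_attach[OF ij(2), of e f] ef(2) nin by simp
        have "x e \<in> f" "x f \<in> e" using e f by (auto simp: P_def)
        show False
        proof (cases "x e = x f")
          case True
          have e': "e = {x e, par i (x e)}" using e unfolding P_def True[symmetric] .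
          have f': "f = {x f, par j (x f)}" using f unfolding P_def True .
          have "par i (x e) = r" using x(3)[OF E(1) ij(1) e'] .
          moreover have "par j (x f) = r" using x(3)[OF E(2) ij(2) f'] .
          ultimately have "e = f" using e' f' True by metis
          then show False using nin(1) ef(3) by metis
        next
          case False
          then have "e = {x e, x f}" "f = {x e, x f}"
            using edge_eq[OF E(1) x(1)[OF E(1)] \<open>x f \<in> e\<close>]
              edge_eq[OF E(2) \<open>x e \<in> f\<close> x(1)[OF E(2)]] by metis+
          then show False using nin(1) ef(3) by metis
        qed
      qed
      have "e \<in> F i \<or> f \<in> F i" "e \<in> F j \<or> f \<in> F j"
        using H_meets[of i e f] H_meets[of j e f] a ef ij by auto
      moreover have "\<not> (e \<in> F i \<and> e \<in> F j)" "\<not> (f \<in> F i \<and> f \<in> F j)" using disj[OF ij] by auto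
      ultimately have "e \<in> F i \<and> f \<in> F j \<or> f \<in> F i \<and> e \<in> F j" by blast
      then show False using hyp[of e f] hyp[of f e] a ef by (auto simp: insert_commute)
    qed
  next
    fix i a w b assume i: "i < k" and "{a, w} \<in> H i" "{w, b} \<in> H i" "a \<noteq> b"
    then show "w \<in> F i"
      using H_attach[OF i, of w a] H_attach[OF i, of w b] by (auto simp: insert_commute)
  qed (use H_sub disj in auto)
qed

section \<open>Consequences of connectivity of the line graph\<close>

lemma k_connected_card_ge:
  assumes "k_connected K L" and "finite (verts L)" and "S \<subseteq> verts L"
    and "\<not> connected_graph (delete_verts L S) \<or> card (verts (delete_verts L S)) \<le> 1"
  shows "K \<le> card S"
proof -
  have "vertex_connectivity L \<le> card S"
    unfolding vertex_connectivity_def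
  proof (rule Min_le)
    show "finite (card ` {S. S \<subseteq> verts L \<and> (\<not> connected_graph (delete_verts L S)
      \<or> card (verts (delete_verts L S)) \<le> 1)})"
      using assms(2) by simp
  qed (use assms in auto)
  then show ?thesis using assms(1) by (simp add: k_connected_def)
qed

text \<open>Once all other edges of \<open>G\<close> are deleted from the line graph,
  \<open>A\<close> is closed under adjacency and thus cut off from \<open>B\<close>.\<close>

lemma k_connected_line_graph_separator:
  assumes G: "simple_graph G" and K: "k_connected K (line_graph G)"
    and AB: "A \<subseteq> edges G" "B \<subseteq> edges G" "A \<noteq> {}" "B \<noteq> {}"
    and sep: "\<And>e f. e \<in> A \<Longrightarrow> f \<in> B \<Longrightarrow> e \<inter> f = {}"
  shows "K \<le> card (edges G - (A \<union> B))"
proof (rule k_connected_card_ge[OF K])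
  let ?S = "edges G - (A \<union> B)"
  let ?D = "delete_verts (line_graph G) ?S"
  show "finite (verts (line_graph G))"
    using simple_graph_line_graph[OF G] by (simp add: simple_graph_def)
  show "?S \<subseteq> verts (line_graph G)" by (auto simp: line_graph_def)
  have verts: "verts ?D = A \<union> B" using AB by (auto simp: delete_verts_def line_graph_def)
  have "\<not> connected_graph ?D"
  proof
    assume conn: "connected_graph ?D"
    obtain a b where ab: "a \<in> A" "b \<in> B" using AB by auto
    then obtain p where p: "path_between ?D a b p"
      using conn verts unfolding connected_graph_def by blast
    then have "(a, b) \<in> linked (edges ?D)"
      using path_edges_linked[of p "edges ?D"] by (auto simp: path_between_def is_path_def)
    then have "b \<in> A"
    proof (rule linked_closed)
      fix e f assume ef: "{e, f} \<in> edges ?D" and e: "e \<in> A"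
      then have "f \<in> A \<union> B" "e \<inter> f \<noteq> {}"
        by (auto simp: delete_verts_def line_graph_def doubleton_eq_iff)
      then show "f \<in> A" using sep[OF e] by blast
    qed (rule ab(1))
    \<comment> \<open>A common element of \<open>A\<close> and \<open>B\<close> would be disjoint
      from itself, but an edge has two elements.\<close>
    then have "b = {}" using sep[OF _ ab(2)] by auto
    then have "{} \<in> edges G" using ab(2) AB(2) by auto
    then show False using G unfolding simple_graph_def by fastforce
  qed
  then show "\<not> connected_graph ?D \<or> card (verts ?D) \<le> 1" ..
qed

text \<open>In the line graph \<open>{u, v}\<close> has at most
  \<open>degree G u + degree G v - 2\<close> neighbours, being itself counted in both degrees.
  Deleting them isolates it, or leaves nothing else if every edge meets
  \<open>{u, v}\<close>.\<close>

lemma k_connected_line_graph_degree_sum: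
  assumes G: "simple_graph G" and K: "k_connected K (line_graph G)" and uv: "{u, v} \<in> edges G"
  shows "K + 2 \<le> degree G u + degree G v"
proof -
  let ?e = "{u, v}" and ?E = "edges G"
  let ?S = "{f \<in> ?E. f \<noteq> ?e \<and> f \<inter> ?e \<noteq> {}}" and ?B = "{f \<in> ?E. f \<inter> ?e = {}}"
  have finE: "finite ?E"
    using simple_graph_line_graph[OF G] by (simp add: simple_graph_def line_graph_def)
  have "K \<le> card ?S"
  proof (cases "?B = {}")
    case True
    then have "verts (delete_verts (line_graph G) ?S) \<subseteq> {?e}"
      by (auto simp: delete_verts_def line_graph_def)
    then have "card (verts (delete_verts (line_graph G) ?S)) \<le> 1"
      using card_mono[of "{?e}"] by fastforce
    then show ?thesis
      using finE by (intro k_connected_card_ge[OF K]) (auto simp: line_graph_def)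
  next
    case False
    have "K \<le> card (?E - ({?e} \<union> ?B))"
      using uv False by (intro k_connected_line_graph_separator[OF G K]) auto
    also have "?E - ({?e} \<union> ?B) = ?S" by auto
    finally show ?thesis .
  qed
  also have "?S \<subseteq> ({f \<in> ?E. u \<in> f} - {?e}) \<union> ({f \<in> ?E. v \<in> f} - {?e})" by auto
  then have "card ?S \<le> card (({f \<in> ?E. u \<in> f} - {?e}) \<union> ({f \<in> ?E. v \<in> f} - {?e}))"
    using finE by (intro card_mono) auto
  also have "\<dots> \<le> card ({f \<in> ?E. u \<in> f} - {?e}) + card ({f \<in> ?E. v \<in> f} - {?e})"
    by (rule card_Un_le)
  finally have "K \<le> card ({f \<in> ?E. u \<in> f} - {?e}) + card ({f \<in> ?E. v \<in> f} - {?e})" .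
  moreover have "Suc (card ({f \<in> ?E. u \<in> f} - {?e})) = degree G u"
    unfolding degree_def using finE uv by (intro card_Suc_Diff1) auto
  moreover have "Suc (card ({f \<in> ?E. v \<in> f} - {?e})) = degree G v"
    unfolding degree_def using finE uv by (intro card_Suc_Diff1) auto
  ultimately show ?thesis by linarith
qed

theorem theorem5:
  fixes G :: "'a ugraph" and k :: nat
  assumes "k \<ge> 2"
    and "simple_graph G"
    and "k_connected (k^2 + 2*k - 1) (line_graph G)"
    and "min_degree G \<ge> k + 1"
  shows "has_completely_independent_spanning_trees (line_graph G) k"
proof -
  let ?V = "verts G" and ?E = "edges G"
  have finV: "finite ?V" and edge: "\<And>e. e \<in> ?E \<Longrightarrow> e \<subseteq> ?V \<and> card e = 2"
    using assms(2) by (auto simp: simple_graph_def)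
  \<comment> \<open>Without edges the line graph is empty, so deleting no vertex already qualifies
    and the connectivity is 0.\<close>
  have ne: "?E \<noteq> {}"
  proof
    assume "?E = {}"
    then have "k^2 + 2*k - 1 \<le> card ({} :: 'a set set)"
      by (intro k_connected_card_ge[OF assms(3)]) (auto simp: line_graph_def delete_verts_def)
    then show False using assms(1) by simp
  qed
  have deg: "k + 1 \<le> card {e \<in> ?E. v \<in> e}" if "v \<in> ?V" for v
  proof -
    have "min_degree G \<le> degree G v"
      unfolding min_degree_def using that finV by (intro Min_le) auto
    then show ?thesis using assms(4) by (simp add: degree_def)
  qed
  have deg2: "k^2 + 2*k + 1 \<le> card {e \<in> ?E. u \<in> e} + card {e \<in> ?E. v \<in> e}" if "{u, v} \<in> ?E" for u v
    using k_connected_line_graph_degree_sum[OF assms(2,3) that] assms(1) by (simp add: degree_def)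
  \<comment> \<open>Edges inside \<open>X\<close> never meet edges inside the complement, so the
    edges in between separate the line graph.\<close>
  have cut: "k^2 + 2*k - 1 \<le> card {e \<in> ?E. \<not> e \<subseteq> X \<and> \<not> e \<subseteq> ?V - X}"
    if "\<exists>e \<in> ?E. e \<subseteq> X" "\<exists>e \<in> ?E. e \<subseteq> ?V - X" for X
  proof -
    have "k^2 + 2*k - 1 \<le> card (?E - ({e \<in> ?E. e \<subseteq> X} \<union> {e \<in> ?E. e \<subseteq> ?V - X}))"
      using that by (intro k_connected_line_graph_separator[OF assms(2,3)]) auto
    also have "?E - ({e \<in> ?E. e \<subseteq> X} \<union> {e \<in> ?E. e \<subseteq> ?V - X})
      = {e \<in> ?E. \<not> e \<subseteq> X \<and> \<not> e \<subseteq> ?V - X}" by auto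
    finally show ?thesis .
  qed
  have "k * (card (c ` ?V) - 1) \<le> card {e \<in> ?E. \<exists>u \<in> e. \<exists>v \<in> e. c u \<noteq> c v}" for c :: "'a \<Rightarrow> 'a set"
    using assms(1) by (intro cross_edges_bound finV edge deg deg2 cut) auto
  then obtain F where "\<And>i. i < k \<Longrightarrow> F i \<subseteq> ?E"
    and "\<And>i j. i < k \<Longrightarrow> j < k \<Longrightarrow> i \<noteq> j \<Longrightarrow> F i \<inter> F j = {}"
    and "\<And>i u v. i < k \<Longrightarrow> u \<in> ?V \<Longrightarrow> v \<in> ?V \<Longrightarrow> (u, v) \<in> linked (F i)"
    using tree_packing[OF finV edge] by blast
  then show ?thesis by (rule line_graph_completely_independent[OF assms(2) ne])
qed

end
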